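(* Let $\mathcal{S}\in\{\mathbb{R}^n,\mathbb{C}^n\}$, let $\mathcal{D}\subseteq\mathcal{S}$ be a domain such that $\mathcal{D}=\overline{\operatorname{Int}(\mathcal{D})}$ (the closure of its interior), and let $p$ be a polynomial over $\mathcal{D}$. Let $G(p)$ be the set of points in general position on the variety $V(p)=\{x\in\mathcal{S}: p(x)=0\}$. If $\operatorname{Int}(\mathcal{D})\cap G(p)\neq\emptyset$, then $p$ is not accurately evaluable on $\mathcal{D}$ (in traditional arithmetic).
   Context: Allowable sets. The allowable hyperplanes in $\mathcal{S}$ are $Z_i=\{x: x_i=0\}$, $S_{ij}=\{x: x_i+x_j=0\}$ and $D_{ij}=\{x: x_i-x_j=0\}$ ($i\neq j$). A variety $V(p)$ is allowable if it is a (finite) union of intersections of allowable hyperplanes, and unallowable otherwise. General position. Consider all sets $W$ that are finite intersections of allowable hyperplanes, and subtract from $V(p)$ all those $W$ for which $W\subset V(p)$. The remaining subset of $V(p)$ is denoted $G(p)$, and its elements are the points in general position. (If $V(p)$ is unallowable then $G(p)\ne\emptyset$; if it is allowable then $G(p)=\emptyset$.) Traditional arithmetic. Let $F=\mathbb{R}$ or $\mathbb{C}$ according to $\mathcal{S}=F^n$. An algorithm receives the input $x=(x_1,\dots,x_n)\in\mathcal{S}$ exactly and is a finite directed acyclic graph with input, computational, branching and output nodes. Each computational node takes two inputs $a,b$ (which may come from the same node), performs one operation $op\in\{+,-,\times\}$, and returns $op(a,b)(1+\delta_i)$, where $\delta_i\in F$ is a rounding error attached to that node; the $\delta_i$ of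 different nodes are independent variables (nondeterministic model). Negation is also available and is exact. No constants are available. The algorithm may or may not use comparisons and branching. It always terminates in finitely many steps; its output is denoted $p_{comp}(x,\delta)$, where $\delta=(\delta_1,\dots,\delta_k)$ is the vector of rounding errors, and it computes $p$ exactly when there is no rounding error: $p_{comp}(x,0)=p(x)$. Accuracy. The algorithm is accurate for $p$ on $\mathcal{D}$ if for every $0<\eta<1$ there is $0<\epsilon<1$ such that for all $x\in\mathcal{D}$ and all $\delta$ with $|\delta_i|\le\epsilon$ for every $i$, $|p_{comp}(x,\delta)-p(x)|\le\eta\,|p(x)|$. The polynomial $p$ is accurately evaluable on $\mathcal{D}$ if there exists an accurate algorithm for $p$ on $\mathcal{D}$. *)

theory Defs
  imports "HOL-Analysis.Analysis" "HOL-Library.Poly_Mapping"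
begin

section \<open>Polynomials, allowable sets and general position\<close>

text \<open>
  A polynomial in the variables indexed by \<open>'n\<close> maps each monomial, given by its
  exponent vector, to its coefficient.
\<close>

type_synonym ('n, 'a) mpoly = "('n \<Rightarrow>\<^sub>0 nat) \<Rightarrow>\<^sub>0 'a"

definition eval_mpoly :: "('n::finite, 'a::comm_semiring_1) mpoly \<Rightarrow> 'a ^ 'n \<Rightarrow> 'a" where
  "eval_mpoly p x = (\<Sum>m\<in>Poly_Mapping.keys p.
       Poly_Mapping.lookup p m * (\<Prod>i\<in>UNIV. (x $ i) ^ Poly_Mapping.lookup m i))"

definition variety :: "('n::finite, 'a::comm_semiring_1) mpoly \<Rightarrow> ('a ^ 'n) set" where
  "variety p = {x. eval_mpoly p x = 0}"

definition allowable_hyperplanes :: "('a::field ^ 'n) set set" where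
  "allowable_hyperplanes =
     {{x. x $ i = 0} | i. True} \<union>
     {{x. x $ i + x $ j = 0} | i j. i \<noteq> j} \<union>
     {{x. x $ i - x $ j = 0} | i j. i \<noteq> j}"

text \<open>
  The empty intersection is admitted and is the whole space. This matters only for
  \<open>p = 0\<close>, whose variety is thereby allowable and has no points in general position.
\<close>

definition allowable_intersections :: "('a::field ^ 'n) set set" where
  "allowable_intersections = {\<Inter>\<H> | \<H>. finite \<H> \<and> \<H> \<subseteq> allowable_hyperplanes}"

definition general_position :: "('n::finite, 'a::field) mpoly \<Rightarrow> ('a ^ 'n) set" where
  "general_position p = variety p - \<Union>{W \<in> allowable_intersections. W \<subseteq> variety p}"


section \<open>Algorithms in traditional arithmetic\<close>

datatype arith_op = Add | Subtract | Multiply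

fun apply_op :: "arith_op \<Rightarrow> 'a::ring \<Rightarrow> 'a \<Rightarrow> 'a" where
  "apply_op Add a b = a + b"
| "apply_op Subtract a b = a - b"
| "apply_op Multiply a b = a * b"

text \<open>
  Nodes are named by natural numbers. A computational, negation or output node names
  the nodes that supply its operands. The control flow passes through the
  non-input nodes: the last argument of \<open>Compute\<close> and \<open>Negate\<close> is the next node,
  and \<open>Branch R a b u v\<close> continues at \<open>u\<close> if \<open>R\<close> holds of the values of \<open>a\<close> and \<open>b\<close>
  and at \<open>v\<close> otherwise. There is no node for a constant.
\<close>

datatype ('n, 'a) node =
    Input 'n
  | Compute arith_op nat nat nat
  | Negate nat nat
  | Branch "'a \<Rightarrow> 'a \<Rightarrow> bool" nat nat nat nat
  | Output nat

fun operands :: "('n, 'a) node \<Rightarrow> nat set" where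
  "operands (Input i) = {}"
| "operands (Compute f a b u) = {a, b}"
| "operands (Negate a u) = {a}"
| "operands (Branch R a b u v) = {a, b}"
| "operands (Output a) = {a}"

fun successors :: "('n, 'a) node \<Rightarrow> nat set" where
  "successors (Input i) = {}"
| "successors (Compute f a b u) = {u}"
| "successors (Negate a u) = {u}"
| "successors (Branch R a b u v) = {u, v}"
| "successors (Output a) = {}"

record ('n, 'a) algorithm =
  nodes :: "nat set"
  label :: "nat \<Rightarrow> ('n, 'a) node"
  start :: nat

definition edges :: "('n, 'a) algorithm \<Rightarrow> (nat \<times> nat) set" where
  "edges G = {(u, v). v \<in> nodes G \<and> u \<in> operands (label G v)} \<union>
             {(u, v). u \<in> nodes G \<and> v \<in> successors (label G u)}"

definition computational_nodes :: "('n, 'a) algorithm \<Rightarrow> nat set" where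
  "computational_nodes G = {v \<in> nodes G. \<exists>f a b u. label G v = Compute f a b u}"

text \<open>
  \<open>exec G \<delta> e v y\<close>: started at node \<open>v\<close>, with \<open>e\<close> holding the values computed so far,
  the algorithm outputs \<open>y\<close>. The rounding error of the computational node \<open>v\<close> is \<open>\<delta> v\<close>;
  the other components of \<open>\<delta>\<close> are irrelevant.
\<close>

inductive exec ::
  "('n, 'a::comm_ring_1) algorithm \<Rightarrow> (nat \<Rightarrow> 'a) \<Rightarrow> (nat \<Rightarrow> 'a option) \<Rightarrow> nat \<Rightarrow> 'a \<Rightarrow> bool"
  for G :: "('n, 'a::comm_ring_1) algorithm" and \<delta> :: "nat \<Rightarrow> 'a"
where
  compute: "exec G \<delta> e v y"
    if "label G v = Compute f a b u" "e a = Some r" "e b = Some s"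
       "exec G \<delta> (e(v \<mapsto> apply_op f r s * (1 + \<delta> v))) u y"
| negate: "exec G \<delta> e v y"
    if "label G v = Negate a u" "e a = Some r" "exec G \<delta> (e(v \<mapsto> - r)) u y"
| branch: "exec G \<delta> e v y"
    if "label G v = Branch R a b u w" "e a = Some r" "e b = Some s"
       "exec G \<delta> e (if R r s then u else w) y"
| out: "exec G \<delta> e v y"
    if "label G v = Output a" "e a = Some y"

definition input_values :: "('n::finite, 'a) algorithm \<Rightarrow> 'a ^ 'n \<Rightarrow> nat \<Rightarrow> 'a option" where
  "input_values G x v =
     (if v \<in> nodes G then (case label G v of Input i \<Rightarrow> Some (x $ i) | _ \<Rightarrow> None) else None)"

definition outputs ::
  "('n::finite, 'a::comm_ring_1) algorithm \<Rightarrow> 'a ^ 'n \<Rightarrow> (nat \<Rightarrow> 'a) \<Rightarrow> 'a \<Rightarrow> bool" where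
  "outputs G x \<delta> y \<longleftrightarrow> exec G \<delta> (input_values G x) (start G) y"

lemma exec_deterministic: "exec G \<delta> e v y \<Longrightarrow> exec G \<delta> e v z \<Longrightarrow> y = z"
proof (induction arbitrary: z rule: exec.induct)
  case compute
  from compute.prems compute.hyps show ?case by (cases rule: exec.cases) (auto intro: compute.IH)
next
  case negate
  from negate.prems negate.hyps show ?case by (cases rule: exec.cases) (auto intro: negate.IH)
next
  case branch
  from branch.prems branch.hyps show ?case by (cases rule: exec.cases) (auto intro: branch.IH)
next
  case out
  from out.prems out.hyps show ?case by (cases rule: exec.cases) auto
qed

lemma outputs_unique: "outputs G x \<delta> y \<Longrightarrow> outputs G x \<delta> z \<Longrightarrow> y = z"
  unfolding outputs_def by (rule exec_deterministic)

definition p_comp :: "('n::finite, 'a::comm_ring_1) algorithm \<Rightarrow> 'a ^ 'n \<Rightarrow> (nat \<Rightarrow> 'a) \<Rightarrow> 'a" where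
  "p_comp G x \<delta> = (THE y. outputs G x \<delta> y)"

text \<open>
  \<open>C\<close> is the set of comparisons that branching nodes may use. The last condition says
  that every run reaches an output node and never uses a value that has not been computed.
\<close>

definition is_algorithm ::
  "('a::comm_ring_1 \<Rightarrow> 'a \<Rightarrow> bool) set \<Rightarrow> ('n::finite, 'a) algorithm \<Rightarrow> bool" where
  "is_algorithm C G \<longleftrightarrow>
     finite (nodes G) \<and> start G \<in> nodes G \<and>
     edges G \<subseteq> nodes G \<times> nodes G \<and> acyclic (edges G) \<and>
     (\<forall>v\<in>nodes G. \<forall>R a b u w. label G v = Branch R a b u w \<longrightarrow> R \<in> C) \<and>
     (\<forall>x \<delta>. \<exists>y. outputs G x \<delta> y)"

text \<open>
  Other comparisons, such as \<open>\<le>\<close>, arise by swapping the operands or the two successors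
  of a branching node. As \<open>\<complex>\<close> carries no canonical order, complex numbers may be tested for
  equality and compared by real part, imaginary part or modulus.
\<close>

definition real_comparisons :: "(real \<Rightarrow> real \<Rightarrow> bool) set" where
  "real_comparisons = {(=), (<)}"

definition complex_comparisons :: "(complex \<Rightarrow> complex \<Rightarrow> bool) set" where
  "complex_comparisons =
     {(=), \<lambda>z w. Re z < Re w, \<lambda>z w. Im z < Im w, \<lambda>z w. cmod z < cmod w}"


section \<open>Accuracy\<close>

definition computes :: "('n::finite, 'a::comm_ring_1) algorithm \<Rightarrow> ('n, 'a) mpoly \<Rightarrow> bool" where
  "computes G p \<longleftrightarrow> (\<forall>x. p_comp G x (\<lambda>_. 0) = eval_mpoly p x)"

definition accurate ::
  "('n::finite, 'a::real_normed_field) algorithm \<Rightarrow> ('n, 'a) mpoly \<Rightarrow> ('a ^ 'n) set \<Rightarrow> bool" where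
  "accurate G p D \<longleftrightarrow>
     (\<forall>\<eta>. 0 < \<eta> \<and> \<eta> < 1 \<longrightarrow>
       (\<exists>\<epsilon>. 0 < \<epsilon> \<and> \<epsilon> < 1 \<and>
         (\<forall>x\<in>D. \<forall>\<delta>. (\<forall>v\<in>computational_nodes G. norm (\<delta> v) \<le> \<epsilon>) \<longrightarrow>
           norm (p_comp G x \<delta> - eval_mpoly p x) \<le> \<eta> * norm (eval_mpoly p x))))"

definition accurately_evaluable ::
  "('a::real_normed_field \<Rightarrow> 'a \<Rightarrow> bool) set \<Rightarrow> ('n::finite, 'a) mpoly \<Rightarrow> ('a ^ 'n) set \<Rightarrow> bool" where
  "accurately_evaluable C p D \<longleftrightarrow> (\<exists>G. is_algorithm C G \<and> computes G p \<and> accurate G p D)"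

end

theory Submission
  imports Defs
begin

text \<open>
  Suppose an accurate algorithm exists and let \<open>x\<close> be a zero of \<open>p\<close> inside \<open>D\<close>. At \<open>x\<close> the relative
  error bound forces the output to be exactly \<open>0\<close> for \<^emph>\<open>every\<close> small rounding vector. The rounding
  errors can be picked one at a time, each when its node is executed, and picked so that the new
  value coincides with no earlier value and ties with none in a comparison, unless the exact
  result is already \<open>0\<close>. Then every coincidence met during the run is inherited from one among
  \<open>0\<close> and the signed inputs \<open>\<plusminus> x\<^sub>i\<close>. At a point \<open>y\<close> that is close to \<open>x\<close> and has the same coincidences
  among its signed coordinates, the same rounding errors drive the algorithm along the same path
  (strict comparisons survive by continuity, ties by construction) and again to the output \<open>0\<close>;
  accuracy at \<open>y\<close> gives \<open>p y = 0\<close>. This is \<open>zero_along_ties\<close>, which rests on \<open>exec_shadowed\<close> and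
  \<open>tracked_compute\<close>.

  Coincidences of the values \<open>0, \<plusminus> x\<^sub>i\<close> are exactly memberships in allowable hyperplanes. Over the reals
  \<open>p\<close> therefore vanishes near \<open>x\<close> on the intersection \<open>W\<close> of the allowable hyperplanes through \<open>x\<close>,
  hence on all of \<open>W\<close> since it is a polynomial. So \<open>x \<in> W \<subseteq> V(p)\<close> is not in general position.

  Over the complex numbers a branch may also react to \<open>Re x\<^sub>i = Re x\<^sub>j\<close>, \<open>Im x\<^sub>i = Im x\<^sub>j\<close> or
  \<open>\<bar>x\<^sub>i\<bar> = \<bar>x\<^sub>j\<bar>\<close>, which do not define allowable sets. Two symmetries remove them. All these ties are
  kept when \<open>x\<close> is multiplied by a real number, so \<open>p\<close> vanishes at \<open>t x\<close> for real \<open>t\<close> near \<open>1\<close>, hence at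
  \<open>c x\<close> for every complex \<open>c\<close>. Replacing \<open>x\<close> by \<open>c x\<close> with \<open>c\<close> generic and near \<open>1\<close> destroys all
  accidental ties of real and imaginary parts and leaves \<open>W\<close> unchanged. Ties of moduli are kept
  when the coordinates are multiplied by numbers of modulus \<open>1\<close>, and a polynomial that vanishes on
  this torus of rotated points near \<open>c x\<close> vanishes on \<open>W\<close> (\<open>allowable_hull_in_variety\<close>).
\<close>

section \<open>Comparisons by a real key\<close>

text \<open>
  Real and complex comparisons are treated together: apart from equality, each one compares the
  values of a real-valued key, namely the identity, \<open>Re\<close>, \<open>Im\<close> or \<open>cmod\<close>.
\<close>

definition key_comparisons ::
  "('a \<Rightarrow> real) set \<Rightarrow> ('a \<Rightarrow> 'a \<Rightarrow> bool) set" where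
  "key_comparisons \<Phi> = insert (=) ((\<lambda>\<phi> z w. \<phi> z < \<phi> w) ` \<Phi>)"

text \<open>
  Negligible level sets let a perturbed value avoid finitely many ties. The parity condition
  decides whether a value ties with its own negative: always for an even key, and only where the
  key is \<open>0\<close> for an odd one.
\<close>

definition comparison_key :: "('a::euclidean_space \<Rightarrow> real) \<Rightarrow> bool" where
  "comparison_key \<phi> \<longleftrightarrow> continuous_on UNIV \<phi> \<and> (\<forall>c. negligible {t. \<phi> t = c}) \<and>
     ((\<forall>t. \<phi> (- t) = - \<phi> t) \<or> (\<forall>t. \<phi> (- t) = \<phi> t))"

lemma real_comparisons_eq: "real_comparisons = key_comparisons {\<lambda>x. x}"
  by (auto simp: real_comparisons_def key_comparisons_def)

lemma complex_comparisons_eq: "complex_comparisons = key_comparisons {Re, Im, cmod}"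
  by (auto simp: complex_comparisons_def key_comparisons_def)

lemma key_real: "comparison_key (\<lambda>x::real. x)"
  by (auto simp: comparison_key_def)

lemma key_Re: "comparison_key Re"
proof -
  have "{t. Re t = c} = {t. 1 \<bullet> t = c}" for c by (simp add: inner_complex_def)
  then have "negligible {t. Re t = c}" for c by (metis negligible_hyperplane one_neq_zero)
  then show ?thesis unfolding comparison_key_def by (auto intro!: continuous_intros)
qed

lemma key_Im: "comparison_key Im"
proof -
  have "{t. Im t = c} = {t. \<i> \<bullet> t = c}" for c by (simp add: inner_complex_def)
  then have "negligible {t. Im t = c}" for c by (metis negligible_hyperplane complex_i_not_zero)
  then show ?thesis unfolding comparison_key_def by (auto intro!: continuous_intros)
qed

lemma key_cmod: "comparison_key cmod"
proof -
  have "{t. cmod t = c} = sphere 0 c" for c by (auto simp: dist_norm)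
  then show ?thesis
    unfolding comparison_key_def by (auto intro!: continuous_intros negligible_sphere)
qed

lemma open_avoids_negligible:
  fixes U :: "'a::euclidean_space set"
  assumes "open U" "U \<noteq> {}" "finite \<A>" "\<And>A. A \<in> \<A> \<Longrightarrow> negligible A"
  shows "\<exists>t\<in>U. t \<notin> \<Union>\<A>"
proof (rule ccontr)
  assume "\<not> ?thesis"
  then have "U \<subseteq> \<Union>\<A>" by blast
  then have "negligible U"
    using negligible_Union[OF assms(3)] assms(4) negligible_subset by blast
  then show False using open_not_negligible assms by blast
qed

section \<open>Perturbation-stable ties between computed values\<close>

text \<open>
  A pair \<open>(r, f)\<close> stands for the germ of a computed value: \<open>r\<close> is the value at the base point and
  \<open>f b\<close> the value at the perturbed point with parameter \<open>b\<close>, where \<open>f\<close> tends to \<open>r\<close> along the filter.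
\<close>

definition ties_persist ::
  "'b filter \<Rightarrow> ('a \<Rightarrow> real) set \<Rightarrow> 'a \<times> ('b \<Rightarrow> 'a) \<Rightarrow> 'a \<times> ('b \<Rightarrow> 'a) \<Rightarrow> bool" where
  "ties_persist F \<Phi> u v \<longleftrightarrow>
     (fst u = fst v \<longrightarrow> (\<forall>\<^sub>F b in F. snd u b = snd v b)) \<and>
     (\<forall>\<phi>\<in>\<Phi>. \<phi> (fst u) = \<phi> (fst v) \<longrightarrow> (\<forall>\<^sub>F b in F. \<phi> (snd u b) = \<phi> (snd v b)))"

definition neg_germ :: "'a::ab_group_add \<times> ('b \<Rightarrow> 'a) \<Rightarrow> 'a \<times> ('b \<Rightarrow> 'a)" where
  "neg_germ u = (- fst u, \<lambda>b. - snd u b)"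

lemma neg_germ_simps [simp]:
  "fst (neg_germ u) = - fst u" "snd (neg_germ u) b = - snd u b" "neg_germ (neg_germ u) = u"
  by (simp_all add: neg_germ_def)

text \<open>
  The invariant of a run. Closure under negation and the presence of \<open>0\<close> turn the vanishing of a
  sum, difference or product into a tie between tracked germs.
\<close>

definition tracked ::
  "'b filter \<Rightarrow> ('a::real_normed_vector \<Rightarrow> real) set \<Rightarrow> ('a \<times> ('b \<Rightarrow> 'a)) set \<Rightarrow> bool" where
  "tracked F \<Phi> V \<longleftrightarrow> finite V \<and> (0, \<lambda>_. 0) \<in> V \<and>
     (\<forall>u\<in>V. neg_germ u \<in> V \<and> (snd u \<longlongrightarrow> fst u) F \<and> (\<forall>v\<in>V. ties_persist F \<Phi> u v))"

lemma ties_persist_refl: "ties_persist F \<Phi> u u"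
  by (simp add: ties_persist_def)

lemma ties_persist_sym: "ties_persist F \<Phi> u v \<Longrightarrow> ties_persist F \<Phi> v u"
  by (simp add: ties_persist_def eq_commute)

lemma ties_persist_neg:
  assumes "ties_persist F \<Phi> u (neg_germ v)" "\<forall>\<phi>\<in>\<Phi>. comparison_key \<phi>"
  shows "ties_persist F \<Phi> (neg_germ u) v"
  unfolding ties_persist_def
proof (intro conjI ballI impI)
  assume "fst (neg_germ u) = fst v"
  then have "fst u = fst (neg_germ v)" by (simp flip: \<open>fst (neg_germ u) = fst v\<close>)
  then have "\<forall>\<^sub>F b in F. snd u b = snd (neg_germ v) b"
    using assms by (simp add: ties_persist_def)
  then show "\<forall>\<^sub>F b in F. snd (neg_germ u) b = snd v b"
    by eventually_elim simp
next
  fix \<phi> assume \<phi>: "\<phi> \<in> \<Phi>" and tie: "\<phi> (fst (neg_germ u)) = \<phi> (fst v)"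
  then have par: "(\<forall>t. \<phi> (- t) = - \<phi> t) \<or> (\<forall>t. \<phi> (- t) = \<phi> t)"
    using assms by (auto simp: comparison_key_def)
  then have "\<phi> (fst u) = \<phi> (fst (neg_germ v))" using tie by auto
  then have "\<forall>\<^sub>F b in F. \<phi> (snd u b) = \<phi> (snd (neg_germ v) b)"
    using assms \<phi> by (simp add: ties_persist_def)
  then show "\<forall>\<^sub>F b in F. \<phi> (snd (neg_germ u) b) = \<phi> (snd v b)"
    by eventually_elim (use par in auto)
qed

lemma tracked_insert:
  assumes V: "tracked F \<Phi> V" and \<Phi>: "\<forall>\<phi>\<in>\<Phi>. comparison_key \<phi>"
    and lim: "(snd u \<longlongrightarrow> fst u) F"
    and old: "\<And>v. v \<in> V \<Longrightarrow> ties_persist F \<Phi> u v"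
    and self: "ties_persist F \<Phi> u (neg_germ u)"
  shows "tracked F \<Phi> (insert u (insert (neg_germ u) V))"
proof -
  have neg: "ties_persist F \<Phi> (neg_germ u) v" if "v \<in> V" for v
  proof (rule ties_persist_neg[OF old \<Phi>])
    show "neg_germ v \<in> V" using that V by (simp add: tracked_def)
  qed
  have "(snd (neg_germ u) \<longlongrightarrow> fst (neg_germ u)) F"
    using tendsto_minus[OF lim] by (simp add: neg_germ_def)
  then show ?thesis
    using V lim old self neg ties_persist_sym[OF self]
    unfolding tracked_def by (auto intro: ties_persist_refl ties_persist_sym)
qed

text \<open>
  Exact cancellation at the base point cannot be an accident: it is a tie \<open>r = - s\<close>, \<open>r = s\<close>,
  \<open>r = 0\<close> or \<open>s = 0\<close> of tracked germs, and so it persists.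
\<close>

lemma tracked_zero_result:
  assumes V: "tracked F \<Phi> V" "(r, f) \<in> V" "(s, g) \<in> V"
    and zero: "apply_op op r s = (0::'a::real_normed_field)"
  shows "\<forall>\<^sub>F b in F. apply_op op (f b) (g b) = 0"
proof -
  have tie: "\<forall>\<^sub>F b in F. snd u b = snd v b" if "u \<in> V" "v \<in> V" "fst u = fst v" for u v
    using V(1) that unfolding tracked_def ties_persist_def by blast
  have V0: "(0, \<lambda>_. 0) \<in> V" and Vneg: "neg_germ (s, g) \<in> V"
    using V by (auto simp: tracked_def)
  show ?thesis
  proof (cases op)
    case Add
    then have "r = - s" using zero by (simp add: eq_neg_iff_add_eq_0)
    then have "\<forall>\<^sub>F b in F. f b = - g b" using tie[OF V(2) Vneg] by simp
    then show ?thesis by eventually_elim (simp add: Add)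
  next
    case Subtract
    then have "\<forall>\<^sub>F b in F. f b = g b" using zero tie[OF V(2,3)] by simp
    then show ?thesis by eventually_elim (simp add: Subtract)
  next
    case Multiply
    then consider "r = 0" | "s = 0" using zero by auto
    then show ?thesis
    proof cases
      case 1
      then have "\<forall>\<^sub>F b in F. f b = 0" using tie[OF V(2) V0] by simp
      then show ?thesis by eventually_elim (simp add: Multiply)
    next
      case 2
      then have "\<forall>\<^sub>F b in F. g b = 0" using tie[OF V(3) V0] by simp
      then show ?thesis by eventually_elim (simp add: Multiply)
    qed
  qed
qed

lemma apply_op_tendsto:
  fixes f g :: "'b \<Rightarrow> 'a::real_normed_field"
  assumes "(f \<longlongrightarrow> r) F" "(g \<longlongrightarrow> s) F"
  shows "((\<lambda>b. apply_op op (f b) (g b)) \<longlongrightarrow> apply_op op r s) F"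
  by (cases op) (auto intro!: tendsto_intros assms)

text \<open>
  The choice of a rounding error. If the exact result \<open>t\<close> is nonzero, then \<open>t * (1 + d)\<close> ranges over a
  neighbourhood of \<open>t\<close>, in which the values tying with one of the finitely many tracked ones form a
  negligible set. If it is \<open>0\<close>, no rounding error changes it, but then it is \<open>0\<close> at the perturbed
  points as well.
\<close>

lemma tracked_compute:
  fixes V :: "('a::{real_normed_field, euclidean_space} \<times> ('b \<Rightarrow> 'a)) set"
  assumes V: "tracked F \<Phi> V" "(r, f) \<in> V" "(s, g) \<in> V"
    and \<Phi>: "finite \<Phi>" "\<forall>\<phi>\<in>\<Phi>. comparison_key \<phi>" and \<epsilon>: "\<epsilon> > 0"
  obtains d V' where "norm d \<le> \<epsilon>" "tracked F \<Phi> V'" "V \<subseteq> V'"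
    "(apply_op op r s * (1 + d), \<lambda>b. apply_op op (f b) (g b) * (1 + d)) \<in> V'"
proof -
  define t where "t = apply_op op r s"
  define h where "h = (\<lambda>b. apply_op op (f b) (g b))"
  have lim: "(h \<longlongrightarrow> t) F"
    unfolding t_def h_def using V by (intro apply_op_tendsto) (auto simp: tracked_def)
  show thesis
  proof (cases "t = 0")
    case True
    have h0: "\<forall>\<^sub>F b in F. h b = 0"
      unfolding h_def using tracked_zero_result[OF V] True by (simp add: t_def)
    have old: "ties_persist F \<Phi> (0, h) v" if "v \<in> V" for v
    proof -
      have "ties_persist F \<Phi> (0, \<lambda>_. 0) v"
        using V(1) that unfolding tracked_def by blast
      then show ?thesis
        unfolding ties_persist_def using h0 by (auto elim: eventually_elim2)
    qed
    have "ties_persist F \<Phi> (0, h) (neg_germ (0, h))"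
      unfolding ties_persist_def using h0 by (auto elim: eventually_mono)
    from tracked_insert[OF V(1) \<Phi>(2) _ old this] lim True
    have "tracked F \<Phi> (insert (0, h) (insert (neg_germ (0, h)) V))" by simp
    then show thesis
      using \<epsilon> True by (intro that[of 0]) (auto simp: t_def h_def)
  next
    case False
    define \<A> where "\<A> = (\<lambda>v. {fst v}) ` V \<union> (\<lambda>(v, \<phi>). {z. \<phi> z = \<phi> (fst v)}) ` (V \<times> \<Phi>)"
    have "finite \<A>" using V \<Phi> by (auto simp: \<A>_def tracked_def)
    moreover have "negligible A" if "A \<in> \<A>" for A
      using that \<Phi>(2) by (auto simp: \<A>_def comparison_key_def)
    moreover have "ball t (\<epsilon> * norm t) \<noteq> {}" using \<epsilon> False by (simp add: not_le)
    ultimately obtain z where z: "z \<in> ball t (\<epsilon> * norm t)" "z \<notin> \<Union>\<A>"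
      using open_avoids_negligible[of "ball t (\<epsilon> * norm t)" \<A>] open_ball by blast
    \<comment> \<open>\<open>z\<close> is the rounded result and \<open>d\<close> the rounding error that produces it.\<close>
    define d where "d = z / t - 1"
    have tz: "t * (1 + d) = z" using False by (simp add: d_def)
    have "d = (z - t) / t" using False by (simp add: d_def field_simps)
    then have "norm d = dist t z / norm t"
      by (simp add: norm_divide dist_norm norm_minus_commute)
    then have d: "norm d \<le> \<epsilon>" using z(1) False by (simp add: pos_divide_le_eq)
    have fresh: "z \<noteq> fst v" "\<phi> \<in> \<Phi> \<Longrightarrow> \<phi> z \<noteq> \<phi> (fst v)" if "v \<in> V" for v \<phi>
      using z(2) that by (auto simp: \<A>_def)
    have V0: "(0, \<lambda>_. 0) \<in> V" using V by (simp add: tracked_def)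
    have z0: "z \<noteq> 0" using fresh(1)[OF V0] by simp
    define k where "k = (\<lambda>b. h b * (1 + d))"
    have old: "ties_persist F \<Phi> (z, k) v" if "v \<in> V" for v
      using fresh[OF that] by (simp add: ties_persist_def)
    have self: "ties_persist F \<Phi> (z, k) (neg_germ (z, k))"
    proof -
      have "z \<noteq> - z"
      proof
        assume "z = - z"
        then have "z + z = 0" by (rule iffD1[OF eq_neg_iff_add_eq_0])
        then have "2 * z = 0" by (simp only: mult_2)
        then show False using z0 by simp
      qed
      moreover have "\<phi> (k b) = \<phi> (- k b)" if \<phi>: "\<phi> \<in> \<Phi>" and tie: "\<phi> z = \<phi> (- z)" for \<phi> b
      proof -
        \<comment> \<open>For an odd key the tie would mean \<open>\<phi> z = 0\<close>, a tie with the tracked value \<open>0\<close>.\<close>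
        have "\<forall>t. \<phi> (- t) = \<phi> t"
        proof (rule ccontr)
          assume "\<not> ?thesis"
          then have odd: "\<phi> (- t) = - \<phi> t" for t using \<Phi>(2) \<phi> by (auto simp: comparison_key_def)
          have "\<phi> z = 0" using odd[of z] tie by simp
          moreover have "\<phi> 0 = 0" using odd[of 0] by simp
          ultimately show False using fresh(2)[OF V0 \<phi>] by simp
        qed
        then show ?thesis by simp
      qed
      ultimately show ?thesis by (simp add: ties_persist_def)
    qed
    have "(k \<longlongrightarrow> z) F"
      unfolding k_def tz[symmetric] by (intro tendsto_intros lim)
    then have "tracked F \<Phi> (insert (z, k) (insert (neg_germ (z, k)) V))"
      using tracked_insert[OF V(1) \<Phi>(2) _ old self] by simp
    then show thesis
      using d by (intro that[of d]) (auto simp: tz t_def[symmetric] k_def h_def)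
  qed
qed

lemma tracked_comparison:
  assumes V: "tracked F \<Phi> V" "(r, f) \<in> V" "(s, g) \<in> V"
    and \<Phi>: "\<forall>\<phi>\<in>\<Phi>. comparison_key \<phi>" and R: "R \<in> key_comparisons \<Phi>"
  shows "\<forall>\<^sub>F b in F. R (f b) (g b) = R r s"
proof -
  have f: "(f \<longlongrightarrow> r) F" and g: "(g \<longlongrightarrow> s) F"
    using V by (auto simp: tracked_def)
  have tie: "ties_persist F \<Phi> (r, f) (s, g)"
    using V unfolding tracked_def by blast
  consider "R = (=)" | \<phi> where "\<phi> \<in> \<Phi>" "R = (\<lambda>z w. \<phi> z < \<phi> w)"
    using R by (auto simp: key_comparisons_def)
  then show ?thesis
  proof cases
    case 1
    show ?thesis
    proof (cases "r = s")
      case True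
      then show ?thesis using tie 1 by (simp add: ties_persist_def)
    next
      case False
      have "((\<lambda>b. f b - g b) \<longlongrightarrow> r - s) F" by (intro tendsto_intros f g)
      then have "\<forall>\<^sub>F b in F. f b - g b \<noteq> 0"
        using False by (intro tendsto_imp_eventually_ne) auto
      then show ?thesis by eventually_elim (use False 1 in auto)
    qed
  next
    case 2
    have cont: "isCont \<phi> c" for c
      using 2 \<Phi> by (auto simp: comparison_key_def continuous_on_eq_continuous_at)
    have f': "((\<lambda>b. \<phi> (f b)) \<longlongrightarrow> \<phi> r) F" and g': "((\<lambda>b. \<phi> (g b)) \<longlongrightarrow> \<phi> s) F"
      using isCont_tendsto_compose[OF cont] f g by blast+
    consider "\<phi> r < \<phi> s" | "\<phi> r = \<phi> s" | "\<phi> s < \<phi> r" by linarith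
    then show ?thesis
    proof cases
      case 1
      have "\<forall>\<^sub>F b in F. 0 < \<phi> (g b) - \<phi> (f b)"
        by (rule order_tendstoD(1)[OF tendsto_diff[OF g' f']]) (use 1 in simp)
      then show ?thesis by eventually_elim (use 1 \<open>R = _\<close> in auto)
    next
      case 2
      then have "\<forall>\<^sub>F b in F. \<phi> (f b) = \<phi> (g b)"
        using tie \<open>\<phi> \<in> \<Phi>\<close> by (simp add: ties_persist_def)
      then show ?thesis by eventually_elim (use 2 \<open>R = _\<close> in auto)
    next
      case 3
      have "\<forall>\<^sub>F b in F. 0 < \<phi> (f b) - \<phi> (g b)"
        by (rule order_tendstoD(1)[OF tendsto_diff[OF f' g']]) (use 3 in simp)
      then show ?thesis by eventually_elim (use 3 \<open>R = _\<close> in auto)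
    qed
  qed
qed

section \<open>Runs from perturbed inputs\<close>

lemma exec_cong:
  assumes "exec G \<delta> e v y" "v \<in> nodes G" "edges G \<subseteq> nodes G \<times> nodes G"
    "\<And>w. (v, w) \<in> (edges G)\<^sup>* \<Longrightarrow> \<delta>' w = \<delta> w"
  shows "exec G \<delta>' e v y"
  using assms(1,2,4)
proof (induction rule: exec.induct)
  case (compute v f a b u e r s y)
  have e: "(v, u) \<in> edges G" using compute by (auto simp: edges_def)
  have "u \<in> nodes G" using e assms(3) by auto
  moreover have "\<delta>' w = \<delta> w" if "(u, w) \<in> (edges G)\<^sup>*" for w
    using compute.prems(2) converse_rtrancl_into_rtrancl[OF e that] by blast
  ultimately have "exec G \<delta>' (e(v \<mapsto> apply_op f r s * (1 + \<delta> v))) u y"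
    using compute.IH by blast
  moreover have "\<delta>' v = \<delta> v" using compute.prems(2) by blast
  ultimately show ?case using compute.hyps exec.compute by metis
next
  case (negate v a u e r y)
  have e: "(v, u) \<in> edges G" using negate by (auto simp: edges_def)
  have "u \<in> nodes G" using e assms(3) by auto
  moreover have "\<delta>' w = \<delta> w" if "(u, w) \<in> (edges G)\<^sup>*" for w
    using negate.prems(2) converse_rtrancl_into_rtrancl[OF e that] by blast
  ultimately have "exec G \<delta>' (e(v \<mapsto> - r)) u y"
    using negate.IH by blast
  then show ?case using negate.hyps exec.negate by metis
next
  case (branch v R a b u w e r s y)
  let ?x = "if R r s then u else w"
  have e: "(v, ?x) \<in> edges G" using branch by (auto simp: edges_def)
  have "?x \<in> nodes G" using e assms(3) by auto
  moreover have "\<delta>' w = \<delta> w" if "(?x, w) \<in> (edges G)\<^sup>*" for w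
    using branch.prems(2) converse_rtrancl_into_rtrancl[OF e that] by blast
  ultimately have "exec G \<delta>' e ?x y"
    using branch.IH by blast
  then show ?case by (rule exec.branch[OF branch.hyps(1-3)])
next
  case (out v a e y)
  then show ?case by (auto intro: exec.out)
qed

text \<open>
  Control never returns to a node, so the rounding error of a node already passed can be
  reassigned. This is what allows the errors to be chosen during the run.
\<close>

lemma exec_upd_past:
  assumes "exec G \<delta> e u y" "(v, u) \<in> edges G" "edges G \<subseteq> nodes G \<times> nodes G" "acyclic (edges G)"
  shows "exec G (\<delta>(v := d)) e u y"
proof (rule exec_cong[OF assms(1) _ assms(3)])
  show "u \<in> nodes G" using assms by auto
  show "(\<delta>(v := d)) w = \<delta> w" if "(u, w) \<in> (edges G)\<^sup>*" for w
  proof -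
    have "(v, w) \<in> (edges G)\<^sup>+" using assms(2) that by (rule rtrancl_into_trancl2)
    then have "w \<noteq> v" using assms(4) by (auto simp: acyclic_def)
    then show ?thesis by simp
  qed
qed

text \<open>\<open>e\<close> holds the values at the base point, \<open>E b\<close> those at the perturbed point \<open>b\<close>.\<close>

definition env_tracked ::
  "(nat \<Rightarrow> 'a option) \<Rightarrow> ('b \<Rightarrow> nat \<Rightarrow> 'a option) \<Rightarrow> ('a \<times> ('b \<Rightarrow> 'a)) set \<Rightarrow> bool" where
  "env_tracked e E V \<longleftrightarrow> (\<forall>a r. e a = Some r \<longrightarrow> (\<exists>f. (\<forall>b. E b a = Some (f b)) \<and> (r, f) \<in> V))"

lemma env_trackedE:
  assumes "env_tracked e E V" "e a = Some r"
  obtains f where "\<And>b. E b a = Some (f b)" "(r, f) \<in> V"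
  using assms unfolding env_tracked_def by blast

lemma env_tracked_upd:
  assumes "env_tracked e E V" "V \<subseteq> V'" "(r, f) \<in> V'"
  shows "env_tracked (e(v \<mapsto> r)) (\<lambda>b. (E b)(v \<mapsto> f b)) V'"
  unfolding env_tracked_def
proof (intro allI impI)
  fix a c assume a: "(e(v \<mapsto> r)) a = Some c"
  show "\<exists>h. (\<forall>b. ((E b)(v \<mapsto> f b)) a = Some (h b)) \<and> (c, h) \<in> V'"
  proof (cases "a = v")
    case True
    then show ?thesis using a assms(3) by auto
  next
    case False
    then have "e a = Some c" using a by simp
    then obtain h where "\<forall>b. E b a = Some (h b)" "(c, h) \<in> V"
      using assms(1) unfolding env_tracked_def by blast
    then show ?thesis using False assms(2) by auto
  qed
qed

text \<open>
  Induction along the acyclic control flow. The hypothesis that every rounding vector leads to an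
  output is needed because the vector is not yet fixed: it is known only once the run has ended.
  At a computational node the error \<open>d\<close> is chosen first, the remaining run supplies the rest of the
  vector, and \<open>d\<close> is then written into it.
\<close>

lemma exec_shadowed:
  fixes G :: "('n, 'a::{real_normed_field, euclidean_space}) algorithm"
  assumes fin: "finite (nodes G)" and sub: "edges G \<subseteq> nodes G \<times> nodes G"
    and ac: "acyclic (edges G)"
    and br: "\<And>v R a b u w. v \<in> nodes G \<Longrightarrow> label G v = Branch R a b u w \<Longrightarrow> R \<in> key_comparisons \<Phi>"
    and \<Phi>: "finite \<Phi>" "\<forall>\<phi>\<in>\<Phi>. comparison_key \<phi>" and \<epsilon>: "\<epsilon> > 0"
    and v: "v \<in> nodes G" and V: "tracked F \<Phi> V" and env: "env_tracked e E V"
    and halts: "\<And>\<delta>. \<exists>z. exec G \<delta> e v z"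
  shows "\<exists>\<delta> z. (\<forall>w. norm (\<delta> w) \<le> \<epsilon>) \<and> exec G \<delta> e v z \<and>
           (\<forall>\<^sub>F b in F. \<exists>z'. exec G \<delta> (E b) v z' \<and> (z = 0 \<longrightarrow> z' = 0))"
proof -
  have "finite (edges G)" using fin sub finite_subset by blast
  then have wf: "wf ((edges G)\<inverse>)" using ac finite_acyclic_wf_converse by blast
  show ?thesis
    using wf v V env halts
  proof (induction v arbitrary: e E V rule: wf_induct_rule)
    case (less v)
    have "\<exists>z. exec G (\<lambda>_. 0) e v z" using less.prems by blast
    then obtain z where "exec G (\<lambda>_. 0) e v z" by blast
    then show ?case
    proof (cases rule: exec.cases)
      case (compute op a b u r s)
      have edge: "(v, u) \<in> edges G" using compute less.prems by (auto simp: edges_def)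
      obtain f where f: "\<And>b. E b a = Some (f b)" "(r, f) \<in> V"
        using env_trackedE[OF less.prems(3) compute(2)] by blast
      obtain g where g: "\<And>c. E c b = Some (g c)" "(s, g) \<in> V"
        using env_trackedE[OF less.prems(3) compute(3)] by blast
      obtain d V' where d: "norm d \<le> \<epsilon>" and V': "tracked F \<Phi> V'" "V \<subseteq> V'"
          "(apply_op op r s * (1 + d), \<lambda>b. apply_op op (f b) (g b) * (1 + d)) \<in> V'"
        using tracked_compute[OF less.prems(2) f(2) g(2) \<Phi> \<epsilon>] by metis
      define e' where "e' = e(v \<mapsto> apply_op op r s * (1 + d))"
      define E' where "E' = (\<lambda>b. (E b)(v \<mapsto> apply_op op (f b) (g b) * (1 + d)))"
      have "env_tracked e' E' V'"
        unfolding e'_def E'_def using env_tracked_upd[OF less.prems(3) V'(2,3)] .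
      moreover have "\<exists>z. exec G \<delta> e' u z" for \<delta>
      proof -
        obtain z where "exec G (\<delta>(v := d)) e v z" using less.prems(4) by blast
        then have "exec G (\<delta>(v := d)) e' u z"
          by (cases rule: exec.cases) (use compute in \<open>auto simp: e'_def\<close>)
        then show ?thesis using exec_upd_past[OF _ edge sub ac, of "\<delta>(v := d)" e' z "\<delta> v"] by auto
      qed
      ultimately obtain \<delta> z where \<delta>: "\<And>w. norm (\<delta> w) \<le> \<epsilon>" "exec G \<delta> e' u z"
          "\<forall>\<^sub>F b in F. \<exists>z'. exec G \<delta> (E' b) u z' \<and> (z = 0 \<longrightarrow> z' = 0)"
        using less.IH[of u V' e' E'] edge sub V'(1) by blast
      define \<delta>' where "\<delta>' = \<delta>(v := d)"
      have step: "exec G \<delta>' e0 v z'"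
        if "e0 a = Some r0" "e0 b = Some s0" "exec G \<delta> (e0(v \<mapsto> apply_op op r0 s0 * (1 + d))) u z'"
        for e0 r0 s0 z'
        using exec.compute[of G, where e=e0, OF compute(1) that(1,2), of \<delta>' z'] exec_upd_past[OF that(3) edge sub ac]
        by (simp add: \<delta>'_def)
      have "\<forall>w. norm (\<delta>' w) \<le> \<epsilon>" using \<delta>(1) d by (simp add: \<delta>'_def)
      moreover have "exec G \<delta>' e v z"
        using step[of e, OF compute(2,3)] \<delta>(2) by (simp add: e'_def)
      moreover have "\<forall>\<^sub>F b in F. \<exists>z'. exec G \<delta>' (E b) v z' \<and> (z = 0 \<longrightarrow> z' = 0)"
        using \<delta>(3)
      proof eventually_elim
        case (elim c)
        then obtain z' where z': "exec G \<delta> ((E c)(v \<mapsto> apply_op op (f c) (g c) * (1 + d))) u z'" "z = 0 \<longrightarrow> z' = 0" unfolding E'_def by blast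
        show ?case using step[of "E c", OF f(1) g(1)] z' by auto
      qed
      ultimately show ?thesis by blast
    next
      case (negate a u r)
      have edge: "(v, u) \<in> edges G" using negate less.prems by (auto simp: edges_def)
      obtain f where f: "\<And>b. E b a = Some (f b)" "(r, f) \<in> V"
        using env_trackedE[OF less.prems(3) negate(2)] by blast
      define e' where "e' = e(v \<mapsto> - r)"
      define E' where "E' = (\<lambda>b. (E b)(v \<mapsto> - f b))"
      have "neg_germ (r, f) \<in> V" using f less.prems(2) by (simp add: tracked_def)
      then have "(- r, \<lambda>b. - f b) \<in> V" by (simp add: neg_germ_def)
      then have "env_tracked e' E' V"
        unfolding e'_def E'_def using env_tracked_upd[OF less.prems(3) order_refl] by blast
      moreover have "\<exists>z. exec G \<delta> e' u z" for \<delta>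
      proof -
        obtain z where "exec G \<delta> e v z" using less.prems(4) by blast
        then have "exec G \<delta> e' u z"
          by (cases rule: exec.cases) (use negate in \<open>auto simp: e'_def\<close>)
        then show ?thesis by blast
      qed
      ultimately obtain \<delta> z where \<delta>: "\<And>w. norm (\<delta> w) \<le> \<epsilon>" "exec G \<delta> e' u z"
          "\<forall>\<^sub>F b in F. \<exists>z'. exec G \<delta> (E' b) u z' \<and> (z = 0 \<longrightarrow> z' = 0)"
        using less.IH[of u V e' E'] edge sub less.prems(2) by blast
      have "exec G \<delta> e v z"
        using exec.negate[of G, where e=e, OF negate(1,2)] \<delta>(2) by (simp add: e'_def)
      moreover have "\<forall>\<^sub>F b in F. \<exists>z'. exec G \<delta> (E b) v z' \<and> (z = 0 \<longrightarrow> z' = 0)"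
        using \<delta>(3)
      proof eventually_elim
        case (elim c)
        then obtain z' where z': "exec G \<delta> ((E c)(v \<mapsto> - f c)) u z'" "z = 0 \<longrightarrow> z' = 0" unfolding E'_def by blast
        show ?case using exec.negate[of G, where e="E c", OF negate(1) f(1)] z' by auto
      qed
      ultimately show ?thesis using \<delta>(1) by blast
    next
      case (branch R a b u w r s)
      define x where "x = (if R r s then u else w)"
      have edge: "(v, x) \<in> edges G" using branch less.prems by (auto simp: edges_def x_def)
      obtain f where f: "\<And>b. E b a = Some (f b)" "(r, f) \<in> V"
        using env_trackedE[OF less.prems(3) branch(2)] by blast
      obtain g where g: "\<And>c. E c b = Some (g c)" "(s, g) \<in> V"
        using env_trackedE[OF less.prems(3) branch(3)] by blast
      have same: "\<forall>\<^sub>F b in F. R (f b) (g b) = R r s"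
        using tracked_comparison[OF less.prems(2) f(2) g(2) \<Phi>(2)] br[OF less.prems(1) branch(1)] .
      have "\<exists>z. exec G \<delta> e x z" for \<delta>
      proof -
        obtain z where "exec G \<delta> e v z" using less.prems(4) by blast
        then have "exec G \<delta> e x z"
          by (cases rule: exec.cases) (use branch in \<open>auto simp: x_def\<close>)
        then show ?thesis by blast
      qed
      then obtain \<delta> z where \<delta>: "\<And>w. norm (\<delta> w) \<le> \<epsilon>" "exec G \<delta> e x z"
          "\<forall>\<^sub>F b in F. \<exists>z'. exec G \<delta> (E b) x z' \<and> (z = 0 \<longrightarrow> z' = 0)"
        using less.IH[of x V e E] edge sub less.prems(2,3) by blast
      have "exec G \<delta> e v z"
        using exec.branch[of G, where e=e, OF branch(1-3)] \<delta>(2) by (simp add: x_def)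
      moreover have "\<forall>\<^sub>F b in F. \<exists>z'. exec G \<delta> (E b) v z' \<and> (z = 0 \<longrightarrow> z' = 0)"
        using \<delta>(3) same
      proof eventually_elim
        case (elim c)
        then obtain z' where z': "exec G \<delta> (E c) x z'" "z = 0 \<longrightarrow> z' = 0" by blast
        show ?case using exec.branch[of G, where e="E c", OF branch(1) f(1) g(1)] elim(2) z' by (auto simp: x_def)
      qed
      ultimately show ?thesis using \<delta>(1) by blast
    next
      case (out a)
      obtain f where f: "\<And>b. E b a = Some (f b)" "(z, f) \<in> V"
        using env_trackedE[OF less.prems(3) out(2)] by blast
      have "exec G (\<lambda>_. 0) e v z" using out by (auto intro: exec.out)
      moreover have "\<forall>\<^sub>F b in F. z = 0 \<longrightarrow> f b = 0"
      proof (cases "z = 0")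
        case True
        have "ties_persist F \<Phi> (z, f) (0, \<lambda>_. 0)"
          using less.prems(2) f(2) unfolding tracked_def by blast
        then show ?thesis using True by (simp add: ties_persist_def)
      qed simp
      then have "\<forall>\<^sub>F b in F. \<exists>z'. exec G (\<lambda>_. 0) (E b) v z' \<and> (z = 0 \<longrightarrow> z' = 0)"
        proof eventually_elim
        case (elim c)
        then show ?case using exec.out[of G, where e="E c", OF out(1) f(1)] by blast
      qed
      ultimately show ?thesis
        using \<epsilon> by (intro exI[of _ "\<lambda>_. 0"] exI[of _ z] conjI allI) auto
    qed
  qed
qed

text \<open>The values on which every coincidence in a generic run depends.\<close>

definition signed_coordinates :: "('a::ab_group_add ^ 'n \<Rightarrow> 'a) set" where
  "signed_coordinates = insert (\<lambda>_. 0) (range (\<lambda>i x. x $ i) \<union> range (\<lambda>i x. - x $ i))"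

definition keeps_ties ::
  "('a::ab_group_add \<Rightarrow> real) set \<Rightarrow> 'a ^ 'n \<Rightarrow> 'a ^ 'n \<Rightarrow> bool" where
  "keeps_ties \<Phi> x y \<longleftrightarrow> (\<forall>l\<in>signed_coordinates. \<forall>m\<in>signed_coordinates.
     (l x = m x \<longrightarrow> l y = m y) \<and> (\<forall>\<phi>\<in>\<Phi>. \<phi> (l x) = \<phi> (m x) \<longrightarrow> \<phi> (l y) = \<phi> (m y)))"

lemma finite_signed_coordinates: "finite (signed_coordinates :: ('a::ab_group_add ^ 'n::finite \<Rightarrow> 'a) set)"
  by (simp add: signed_coordinates_def)

lemma tracked_inputs:
  fixes x :: "'a::{real_normed_field, euclidean_space} ^ 'n::finite"
  assumes X: "(X \<longlongrightarrow> x) F" and ties: "\<forall>\<^sub>F b in F. keeps_ties \<Phi> x (X b)"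
  shows "tracked F \<Phi> ((\<lambda>l. (l x, \<lambda>b. l (X b))) ` signed_coordinates)"
proof -
  have coord: "((\<lambda>b. X b $ i) \<longlongrightarrow> x $ i) F" for i
    by (rule tendsto_vec_nth[OF X])
  have lim: "((\<lambda>b. l (X b)) \<longlongrightarrow> l x) F" if "l \<in> signed_coordinates" for l
    using that coord tendsto_minus[OF coord] unfolding signed_coordinates_def by auto
  have neg: "(\<lambda>x. - l x) \<in> signed_coordinates" if "l \<in> signed_coordinates"
    for l :: "'a ^ 'n \<Rightarrow> 'a"
    using that by (auto simp: signed_coordinates_def)
  have tie: "ties_persist F \<Phi> (l x, \<lambda>b. l (X b)) (m x, \<lambda>b. m (X b))"
    if "l \<in> signed_coordinates" "m \<in> signed_coordinates" for l m
    unfolding ties_persist_def fst_conv snd_conv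
  proof (intro conjI impI ballI)
    show "\<forall>\<^sub>F b in F. l (X b) = m (X b)" if "l x = m x"
      using ties by eventually_elim (use that \<open>l \<in> _\<close> \<open>m \<in> _\<close> in \<open>simp add: keeps_ties_def\<close>)
    show "\<forall>\<^sub>F b in F. \<phi> (l (X b)) = \<phi> (m (X b))" if "\<phi> \<in> \<Phi>" "\<phi> (l x) = \<phi> (m x)" for \<phi>
      using ties by eventually_elim (use that \<open>l \<in> _\<close> \<open>m \<in> _\<close> in \<open>simp add: keeps_ties_def\<close>)
  qed
  show ?thesis
    unfolding tracked_def
  proof (intro conjI ballI)
    show "(0, \<lambda>_. 0) \<in> (\<lambda>l. (l x, \<lambda>b. l (X b))) ` signed_coordinates"
      by (rule image_eqI[of _ _ "\<lambda>_. 0"]) (auto simp: signed_coordinates_def)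
  next
    fix u assume "u \<in> (\<lambda>l. (l x, \<lambda>b. l (X b))) ` signed_coordinates"
    then obtain l where l: "l \<in> signed_coordinates" "u = (l x, \<lambda>b. l (X b))" by blast
    show "neg_germ u \<in> (\<lambda>l. (l x, \<lambda>b. l (X b))) ` signed_coordinates"
      by (rule image_eqI[OF _ neg[OF l(1)]]) (simp add: l(2) neg_germ_def)
    show "(snd u \<longlongrightarrow> fst u) F" using lim[OF l(1)] by (simp add: l(2))
    show "ties_persist F \<Phi> u v" if "v \<in> (\<lambda>l. (l x, \<lambda>b. l (X b))) ` signed_coordinates" for v
      using that tie[OF l(1)] by (auto simp: l(2))
  qed (simp add: finite_signed_coordinates)
qed

text \<open>
  Relative accuracy is used twice, with the same rounding vector: at the zero \<open>x\<close> it makes the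
  computed value exactly \<open>0\<close>, and at \<open>X b\<close>, where the computed value is then \<open>0\<close> too, the bound
  \<open>\<bar>0 - p (X b)\<bar> \<le> \<bar>p (X b)\<bar> / 2\<close> leaves only \<open>p (X b) = 0\<close>.
\<close>

lemma zero_along_ties:
  fixes p :: "('n::finite, 'a::{real_normed_field, euclidean_space}) mpoly"
  assumes \<Phi>: "finite \<Phi>" "\<forall>\<phi>\<in>\<Phi>. comparison_key \<phi>"
    and ev: "accurately_evaluable (key_comparisons \<Phi>) p D"
    and x: "x \<in> interior D" "eval_mpoly p x = 0"
    and X: "(X \<longlongrightarrow> x) F" and ties: "\<forall>\<^sub>F b in F. keeps_ties \<Phi> x (X b)"
  shows "\<forall>\<^sub>F b in F. eval_mpoly p (X b) = 0"
proof -
  obtain G where alg: "is_algorithm (key_comparisons \<Phi>) G" and acc: "accurate G p D"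
    using ev by (auto simp: accurately_evaluable_def)
  obtain \<epsilon> :: real where \<epsilon>: "\<epsilon> > 0" and close:
    "\<And>y \<delta>. y \<in> D \<Longrightarrow> \<forall>v. norm (\<delta> v) \<le> \<epsilon> \<Longrightarrow>
        norm (p_comp G y \<delta> - eval_mpoly p y) \<le> (1/2) * norm (eval_mpoly p y)"
    using acc[unfolded accurate_def, rule_format, of "1/2"] by auto
  define V where "V = (\<lambda>l. (l x, \<lambda>b. l (X b))) ` signed_coordinates"
  have V: "tracked F \<Phi> V" unfolding V_def using tracked_inputs[OF X ties] .
  have env: "env_tracked (input_values G x) (\<lambda>b. input_values G (X b)) V"
    unfolding env_tracked_def
  proof (intro allI impI)
    fix a r assume a: "input_values G x a = Some r"
    then obtain i where i: "a \<in> nodes G" "label G a = Input i" "r = x $ i"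
      by (auto simp: input_values_def split: if_splits node.splits)
    have "(\<lambda>x::'a^'n. x $ i) \<in> signed_coordinates" by (auto simp: signed_coordinates_def)
    then have "(r, \<lambda>b. X b $ i) \<in> V" unfolding V_def i(3) by (rule rev_image_eqI) simp
    then show "\<exists>f. (\<forall>b. input_values G (X b) a = Some (f b)) \<and> (r, f) \<in> V"
      using i by (auto simp: input_values_def)
  qed
  have halts: "\<exists>z. exec G \<delta> (input_values G x) (start G) z" for \<delta>
    using alg by (auto simp: is_algorithm_def outputs_def)
  have "\<exists>\<delta> z. (\<forall>w. norm (\<delta> w) \<le> \<epsilon>) \<and> exec G \<delta> (input_values G x) (start G) z \<and>
      (\<forall>\<^sub>F b in F. \<exists>z'. exec G \<delta> (input_values G (X b)) (start G) z' \<and> (z = 0 \<longrightarrow> z' = 0))"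
    by (rule exec_shadowed[OF _ _ _ _ \<Phi> \<epsilon> _ V env halts])
       (use alg in \<open>auto simp: is_algorithm_def\<close>)
  then obtain \<delta> z where \<delta>: "\<forall>w. norm (\<delta> w) \<le> \<epsilon>"
    and out: "outputs G x \<delta> z"
    and near: "\<forall>\<^sub>F b in F. \<exists>z'. outputs G (X b) \<delta> z' \<and> (z = 0 \<longrightarrow> z' = 0)"
    by (auto simp: outputs_def)
  have result: "p_comp G y \<delta> = w" if "outputs G y \<delta> w" for y w
    unfolding p_comp_def using that outputs_unique by blast
  have "z = 0"
  proof -
    have "x \<in> D" using x(1) interior_subset by blast
    from close[OF this \<delta>] show ?thesis by (simp add: x(2) result[OF out])
  qed
  have "\<forall>\<^sub>F b in F. X b \<in> interior D"
    by (rule topological_tendstoD[OF X open_interior x(1)])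
  then show ?thesis
    using near
  proof eventually_elim
    case (elim b)
    then have 0: "p_comp G (X b) \<delta> = 0" using result \<open>z = 0\<close> by blast
    have "X b \<in> D" using elim(1) interior_subset by blast
    from close[OF this \<delta>] show ?case by (simp add: 0)
  qed
qed

section \<open>The smallest allowable set through a point\<close>

definition allowable_hull :: "'a::field ^ 'n \<Rightarrow> ('a ^ 'n) set" where
  "allowable_hull x = \<Inter>{H \<in> allowable_hyperplanes. x \<in> H}"

lemma allowable_hull_intersection:
  "allowable_hull (x :: 'a::field ^ 'n::finite) \<in> allowable_intersections"
proof -
  have "(allowable_hyperplanes :: ('a ^ 'n) set set) \<subseteq>
      range (\<lambda>i. {x. x $ i = 0}) \<union> range (\<lambda>(i, j). {x. x $ i + x $ j = 0}) \<union>
      range (\<lambda>(i, j). {x. x $ i - x $ j = 0})"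
    unfolding allowable_hyperplanes_def by auto
  then have "finite (allowable_hyperplanes :: ('a ^ 'n) set set)"
    by (rule finite_subset) simp
  then show ?thesis
    unfolding allowable_hull_def allowable_intersections_def
    by (intro CollectI exI[of _ "{H \<in> allowable_hyperplanes. x \<in> H}"]) auto
qed

lemma allowable_hull_coordinates:
  fixes x y :: "'a::field_char_0 ^ 'n"
  shows "y \<in> allowable_hull x \<longleftrightarrow>
    (\<forall>i. x $ i = 0 \<longrightarrow> y $ i = 0) \<and> (\<forall>i j. x $ i = x $ j \<longrightarrow> y $ i = y $ j) \<and>
    (\<forall>i j. x $ i = - x $ j \<longrightarrow> y $ i = - y $ j)"
    (is "_ \<longleftrightarrow> ?R")
proof
  assume y: "y \<in> allowable_hull x"
  have hyp: "y \<in> H" if "H \<in> allowable_hyperplanes" "x \<in> H" for H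
    using y that by (auto simp: allowable_hull_def)
  have zero: "y $ i = 0" if "x $ i = 0" for i
  proof -
    have "{x::'a^'n. x $ i = 0} \<in> allowable_hyperplanes"
      unfolding allowable_hyperplanes_def
      by (rule UnI1, rule UnI1, rule CollectI, rule exI[of _ i]) simp
    from hyp[OF this] show ?thesis using that by simp
  qed
  have minus: "y $ i = y $ j" if "x $ i = x $ j" for i j
  proof (cases "i = j")
    case False
    then have "{x::'a^'n. x $ i - x $ j = 0} \<in> allowable_hyperplanes"
      unfolding allowable_hyperplanes_def
      by (intro UnI2 CollectI exI[of _ i] exI[of _ j] conjI refl)
    from hyp[OF this] show ?thesis using that by simp
  qed simp
  have plus: "y $ i = - y $ j" if "x $ i = - x $ j" for i j
  proof (cases "i = j")
    case True
    have "x $ i + x $ i = 0" using that True by (metis eq_neg_iff_add_eq_0)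
    then have "2 * x $ i = 0" by (simp only: mult_2)
    then show ?thesis using True zero[of i] by simp
  next
    case False
    then have "{x::'a^'n. x $ i + x $ j = 0} \<in> allowable_hyperplanes"
      unfolding allowable_hyperplanes_def
      by (intro UnI1[OF UnI2] CollectI exI[of _ i] exI[of _ j] conjI refl)
    from hyp[OF this] show ?thesis using that by (simp add: eq_neg_iff_add_eq_0)
  qed
  show ?R using zero minus plus by blast
next
  assume R: ?R
  have "y \<in> H" if H: "H \<in> allowable_hyperplanes" "x \<in> H" for H
  proof -
    consider i where "H = {x. x $ i = 0}" | i j where "H = {x. x $ i + x $ j = 0}"
      | i j where "H = {x. x $ i - x $ j = 0}"
      using H(1) unfolding allowable_hyperplanes_def by (elim UnE CollectE exE conjE) metis+
    then show ?thesis
    proof cases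
      case 1
      then show ?thesis using R H(2) by simp
    next
      case (2 i j)
      then have "x $ i = - x $ j" using H(2) by (simp add: eq_neg_iff_add_eq_0)
      then have "y $ i = - y $ j" using R by blast
      then show ?thesis by (simp add: 2)
    next
      case (3 i j)
      then have "x $ i = x $ j" using H(2) by simp
      then have "y $ i = y $ j" using R by blast
      then show ?thesis by (simp add: 3)
    qed
  qed
  then show "y \<in> allowable_hull x" by (simp add: allowable_hull_def)
qed

lemma allowable_hull_iff:
  fixes x y :: "'a::field_char_0 ^ 'n"
  shows "y \<in> allowable_hull x \<longleftrightarrow>
    (\<forall>l\<in>signed_coordinates. \<forall>m\<in>signed_coordinates. l x = m x \<longrightarrow> l y = m y)"
    (is "_ \<longleftrightarrow> ?R")
proof
  assume "y \<in> allowable_hull x"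
  then have zero: "\<And>i. x $ i = 0 \<Longrightarrow> y $ i = 0" and minus: "\<And>i j. x $ i = x $ j \<Longrightarrow> y $ i = y $ j"
    and plus: "\<And>i j. x $ i = - x $ j \<Longrightarrow> y $ i = - y $ j"
    unfolding allowable_hull_coordinates by blast+
  have shape: "l = (\<lambda>_. 0) \<or> (\<exists>i. l = (\<lambda>x. x $ i)) \<or> (\<exists>i. l = (\<lambda>x. - x $ i))"
    if "l \<in> signed_coordinates" for l :: "'a ^ 'n \<Rightarrow> 'a"
    using that unfolding signed_coordinates_def by blast
  show ?R
  proof (intro ballI impI)
    fix l m :: "'a ^ 'n \<Rightarrow> 'a"
    assume lm: "l \<in> signed_coordinates" "m \<in> signed_coordinates" and "l x = m x"
    with shape[OF lm(1)] shape[OF lm(2)] show "l y = m y"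
      by (elim disjE exE; hypsubst; metis zero minus plus minus_minus minus_zero)
  qed
next
  assume R: ?R
  have "y $ i = 0" if "x $ i = 0" for i
    using R[rule_format, of "\<lambda>x. x $ i" "\<lambda>x. 0"] that by (auto simp: signed_coordinates_def)
  moreover have "y $ i = y $ j" if "x $ i = x $ j" for i j
    using R[rule_format, of "\<lambda>x. x $ i" "\<lambda>x. x $ j"] that by (auto simp: signed_coordinates_def)
  moreover have "y $ i = - y $ j" if "x $ i = - x $ j" for i j
    using R[rule_format, of "\<lambda>x. x $ i" "\<lambda>x. - x $ j"] that by (auto simp: signed_coordinates_def)
  ultimately show "y \<in> allowable_hull x"
    unfolding allowable_hull_coordinates by blast
qed

text \<open>
  Coordinates of \<open>x\<close> that agree up to sign must be scaled by the same factor to stay in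
  \<open>allowable_hull x\<close>. Letting the factor of \<open>x\<^sub>i\<close> be a function of \<open>x\<^sub>i\<^sup>2\<close> builds this in, and every
  point of the hull arises in this way.
\<close>

definition rescale :: "'a::field ^ 'n \<Rightarrow> ('a \<Rightarrow> 'a) \<Rightarrow> 'a ^ 'n" where
  "rescale x g = (\<chi> i. g ((x $ i)\<^sup>2) * x $ i)"

lemma rescale_in_allowable_hull: "rescale x g \<in> allowable_hull (x :: 'a::field_char_0 ^ 'n)"
  unfolding allowable_hull_coordinates rescale_def by simp

lemma allowable_hull_rescaleE:
  fixes x w :: "'a::field_char_0 ^ 'n"
  assumes "w \<in> allowable_hull x"
  obtains g where "w = rescale x g"
proof -
  define g where "g v = (let j = (SOME j. (x $ j)\<^sup>2 = v) in w $ j / x $ j)" for v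
  have zero: "\<And>i. x $ i = 0 \<Longrightarrow> w $ i = 0" and minus: "\<And>i j. x $ i = x $ j \<Longrightarrow> w $ i = w $ j"
    and plus: "\<And>i j. x $ i = - x $ j \<Longrightarrow> w $ i = - w $ j"
    using assms unfolding allowable_hull_coordinates by blast+
  have "w $ i = g ((x $ i)\<^sup>2) * x $ i" for i
  proof (cases "x $ i = 0")
    case True
    then show ?thesis using zero by simp
  next
    case False
    define j where "j = (SOME j. (x $ j)\<^sup>2 = (x $ i)\<^sup>2)"
    have "(x $ j)\<^sup>2 = (x $ i)\<^sup>2" unfolding j_def by (rule someI) simp
    then have "x $ j = x $ i \<or> x $ j = - x $ i" by (rule iffD1[OF power2_eq_iff])
    then have "w $ j / x $ j = w $ i / x $ i"
    proof
      assume "x $ j = x $ i"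
      then show ?thesis using minus[of j i] by simp
    next
      assume "x $ j = - x $ i"
      then show ?thesis using plus[of j i] by simp
    qed
    moreover have "g ((x $ i)\<^sup>2) = w $ j / x $ j" unfolding g_def Let_def j_def ..
    ultimately show ?thesis using False by simp
  qed
  then have "w = rescale x g" by (simp add: vec_eq_iff rescale_def)
  then show thesis by (rule that)
qed

text \<open>Along a line \<open>p\<close> is a polynomial in one variable, which has finitely many zeros or is \<open>0\<close>.\<close>

lemma eval_mpoly_line_eq_0:
  fixes p :: "('n::finite, 'a::field) mpoly"
  assumes S: "infinite S" "\<And>c. c \<in> S \<Longrightarrow> eval_mpoly p (\<chi> i. \<alpha> i + c * \<beta> i) = 0"
  shows "eval_mpoly p (\<chi> i. \<alpha> i + c * \<beta> i) = 0"
proof -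
  define q where "q = (\<Sum>m\<in>Poly_Mapping.keys p. [:Poly_Mapping.lookup p m:] *
       (\<Prod>i\<in>UNIV. [:\<alpha> i, \<beta> i:] ^ Poly_Mapping.lookup m i))"
  have q: "poly q c = eval_mpoly p (\<chi> i. \<alpha> i + c * \<beta> i)" for c
    by (simp add: q_def eval_mpoly_def poly_sum poly_prod)
  have "S \<subseteq> {c. poly q c = 0}" using S(2) q by auto
  then have "q = 0" using S(1) poly_roots_finite finite_subset by blast
  then show ?thesis using q[of c] by simp
qed

text \<open>
  The identity principle for polynomials in several variables, the variables being the factors
  \<open>g v\<close>: they are freed from \<open>S\<close> one after the other.
\<close>

lemma eval_mpoly_rescale_eq_0:
  fixes p :: "('n::finite, 'a::field) mpoly"
  assumes S: "infinite S" and zero: "\<And>g. range g \<subseteq> S \<Longrightarrow> eval_mpoly p (rescale x g) = 0"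
  shows "eval_mpoly p (rescale x g) = 0"
proof -
  have *: "eval_mpoly p (rescale x g) = 0" if "finite B" "\<And>v. v \<notin> B \<Longrightarrow> g v \<in> S" for B g
    using that
  proof (induction B arbitrary: g)
    case empty
    then show ?case using zero by blast
  next
    case (insert v B)
    have line: "rescale x (g(v := c)) =
        (\<chi> i. (if (x $ i)\<^sup>2 = v then 0 else g ((x $ i)\<^sup>2) * x $ i) +
              c * (if (x $ i)\<^sup>2 = v then x $ i else 0))" for c
      by (auto simp: rescale_def vec_eq_iff)
    have "eval_mpoly p (rescale x (g(v := c))) = 0" if "c \<in> S" for c
      using insert that by (intro insert.IH) auto
    then have "eval_mpoly p (rescale x (g(v := g v))) = 0"
      unfolding line by (rule eval_mpoly_line_eq_0[OF S])
    then show ?case by simp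
  qed
  obtain s where s: "s \<in> S" using S infinite_imp_nonempty by blast
  define h where "h v = (if v \<in> range (\<lambda>i. (x $ i)\<^sup>2) then g v else s)" for v
  have "rescale x g = rescale x h" by (simp add: rescale_def h_def vec_eq_iff)
  moreover have "eval_mpoly p (rescale x h) = 0"
    using *[of "range (\<lambda>i. (x $ i)\<^sup>2)" h] s by (auto simp: h_def)
  ultimately show ?thesis by simp
qed

text \<open>
  \<open>T\<close> is the set of admissible factors: everything in the real case, the unit circle in the complex
  case. Any set accumulating at \<open>1\<close> provides infinitely many factors near \<open>1\<close>.
\<close>

lemma allowable_hull_in_variety:
  fixes p :: "('n::finite, 'a::real_normed_field) mpoly"
  assumes T: "1 islimpt T"
    and zero: "\<forall>\<^sub>F y in at x within {rescale x g | g. range g \<subseteq> T}. eval_mpoly p y = 0"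
    and x: "eval_mpoly p x = 0"
  shows "allowable_hull x \<subseteq> variety p"
proof -
  obtain d where d: "d > 0" and near:
    "\<And>g. range g \<subseteq> T \<Longrightarrow> dist (rescale x g) x < d \<Longrightarrow> eval_mpoly p (rescale x g) = 0"
    using zero x unfolding eventually_at by (metis (mono_tags, lifting) mem_Collect_eq)
  define \<epsilon> where "\<epsilon> = d / (1 + norm x)"
  have pos: "1 + norm x > 0" using norm_ge_zero[of x] by linarith
  have \<epsilon>: "\<epsilon> > 0" using d pos by (simp add: \<epsilon>_def)
  have "infinite (T \<inter> ball 1 \<epsilon>)" using T \<epsilon> islimpt_eq_infinite_ball by blast
  moreover have "eval_mpoly p (rescale x g) = 0" if g: "range g \<subseteq> T \<inter> ball 1 \<epsilon>" for g
  proof (rule near)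
    have "norm ((rescale x g - x) $ i) \<le> norm ((\<epsilon> *\<^sub>R x) $ i)" for i
    proof -
      have "(rescale x g - x) $ i = (g ((x $ i)\<^sup>2) - 1) * x $ i"
        by (simp add: rescale_def algebra_simps)
      moreover have "norm (g ((x $ i)\<^sup>2) - 1) < \<epsilon>"
        using g by (simp add: image_subset_iff dist_norm norm_minus_commute)
      ultimately show ?thesis
        using \<epsilon> by (simp add: norm_mult mult_right_mono)
    qed
    then have "norm (rescale x g - x) \<le> norm (\<epsilon> *\<^sub>R x)"
      by (rule norm_le_componentwise_cart)
    also have "\<dots> = d * (norm x / (1 + norm x))" using d pos by (simp add: \<epsilon>_def)
    also have "\<dots> < d * 1" using d pos by (intro mult_strict_left_mono) auto
    finally show "dist (rescale x g) x < d" by (simp add: dist_norm)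
  qed (use g in auto)
  ultimately have "eval_mpoly p (rescale x g) = 0" for g
    by (rule eval_mpoly_rescale_eq_0)
  then show ?thesis
    by (auto simp: variety_def elim: allowable_hull_rescaleE)
qed

lemma not_general_position:
  assumes "allowable_hull z \<subseteq> variety p" "x \<in> allowable_hull z"
  shows "x \<notin> general_position p"
  using assms allowable_hull_intersection[of z] by (auto simp: general_position_def)

section \<open>Failure of accurate evaluation in the real and the complex case\<close>

lemma real_not_accurately_evaluable:
  fixes p :: "('n::finite, real) mpoly"
  assumes x: "x \<in> interior D" "x \<in> general_position p"
  shows "\<not> accurately_evaluable real_comparisons p D"
proof
  assume ev: "accurately_evaluable real_comparisons p D"
  have px: "eval_mpoly p x = 0" using x by (auto simp: general_position_def variety_def)
  let ?F = "at x within {rescale x g | g. range g \<subseteq> UNIV}"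
  have "\<forall>\<^sub>F y in ?F. keeps_ties {\<lambda>x. x} x y"
    unfolding eventually_at_filter keeps_ties_def
    by (rule always_eventually) (auto dest: rescale_in_allowable_hull[THEN allowable_hull_iff[THEN iffD1], rule_format])
  then have "\<forall>\<^sub>F y in ?F. eval_mpoly p y = 0"
    using key_real ev x(1) px unfolding real_comparisons_eq
    by (intro zero_along_ties[where x=x and D=D and \<Phi>="{\<lambda>x. x}"]) (auto intro: tendsto_ident_at)
  then have "allowable_hull x \<subseteq> variety p"
    using px by (intro allowable_hull_in_variety[where T=UNIV]) (auto simp: islimpt_UNIV)
  moreover have "x \<in> allowable_hull x" by (simp add: allowable_hull_def)
  ultimately show False using not_general_position x(2) by blast
qed

text \<open>
  Multiplication by a real number \<open>t\<close> multiplies the keys \<open>Re\<close> and \<open>Im\<close> by \<open>t\<close> and \<open>cmod\<close> by \<open>\<bar>t\<bar>\<close>, so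
  no tie is lost. Real factors near \<open>1\<close> then suffice for all complex ones.
\<close>

lemma complex_zero_on_line:
  fixes p :: "('n::finite, complex) mpoly"
  assumes ev: "accurately_evaluable complex_comparisons p D"
    and x: "x \<in> interior D" "eval_mpoly p x = 0"
  shows "eval_mpoly p (c *s x) = 0"
proof -
  let ?X = "\<lambda>t::real. of_real t *s x"
  have scale: "l (of_real t *s x) = of_real t * l x" if "l \<in> signed_coordinates"
    for l and t :: real
    using that by (auto simp: signed_coordinates_def)
  have "keeps_ties {Re, Im, cmod} x (?X t)" for t
    unfolding keeps_ties_def by (auto simp: scale norm_mult)
  then have "\<forall>\<^sub>F t in at 1. keeps_ties {Re, Im, cmod} x (?X t)" by simp
  moreover have "(?X \<longlongrightarrow> x) (at 1)"
    by (rule vec_tendstoI) (auto intro!: tendsto_eq_intros)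
  ultimately have "\<forall>\<^sub>F t in at 1. eval_mpoly p (?X t) = 0"
    using key_Re key_Im key_cmod ev x unfolding complex_comparisons_eq
    by (intro zero_along_ties[where x=x and D=D and \<Phi>="{Re, Im, cmod}"]) auto
  then obtain d where d: "d > 0" "\<And>t. t \<noteq> 1 \<Longrightarrow> dist t 1 < d \<Longrightarrow> eval_mpoly p (?X t) = 0"
    unfolding eventually_at by auto
  define S where "S = (of_real ` {1<..<1 + d} :: complex set)"
  have "infinite S"
    unfolding S_def using d by (subst finite_image_iff) (auto simp: inj_on_def infinite_Ioo)
  moreover have "eval_mpoly p (\<chi> i. 0 + c * x $ i) = 0" if "c \<in> S" for c
    using that d(2) by (auto simp: S_def vector_scalar_mult_def dist_real_def)
  ultimately have "eval_mpoly p (\<chi> i. 0 + c * x $ i) = 0"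
    by (rule eval_mpoly_line_eq_0)
  then show ?thesis by (simp add: vector_scalar_mult_def)
qed

text \<open>
  For each pair of signed coordinates with \<open>l x \<noteq> m x\<close>, the factors \<open>c\<close> for which \<open>l (c x)\<close> and
  \<open>m (c x)\<close> share their real or imaginary part form a real line. A factor \<open>c\<close> off these lines turns
  \<open>x\<close> into a zero \<open>z\<close> at which only ties of moduli can be accidental.
\<close>

lemma complex_not_accurately_evaluable:
  fixes p :: "('n::finite, complex) mpoly"
  assumes x: "x \<in> interior D" "x \<in> general_position p"
  shows "\<not> accurately_evaluable complex_comparisons p D"
proof
  assume ev: "accurately_evaluable complex_comparisons p D"
  have px: "eval_mpoly p x = 0" using x by (auto simp: general_position_def variety_def)
  define \<Delta> where "\<Delta> = {l x - m x | l m. l \<in> signed_coordinates \<and> m \<in> signed_coordinates} - {0}"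
  define \<A> where "\<A> = (\<lambda>a. {c. Re (c * a) = 0}) ` \<Delta> \<union> (\<lambda>a. {c. Im (c * a) = 0}) ` \<Delta>"
  have "\<Delta> \<subseteq> (\<lambda>(l, m). l x - m x) ` (signed_coordinates \<times> signed_coordinates)"
    by (auto simp: \<Delta>_def)
  then have "finite \<Delta>"
    by (rule finite_subset) (simp add: finite_signed_coordinates)
  then have "finite \<A>" by (simp add: \<A>_def)
  have "negligible A" if A: "A \<in> \<A>" for A
  proof -
    obtain a where a: "a \<noteq> 0" "A = {c. Re (c * a) = 0} \<or> A = {c. Im (c * a) = 0}"
      using A by (auto simp: \<A>_def \<Delta>_def)
    have "{c. Re (c * a) = 0} = {c. cnj a \<bullet> c = 0}" "{c. Im (c * a) = 0} = {c. (\<i> * cnj a) \<bullet> c = 0}"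
      by (auto simp: inner_complex_def algebra_simps)
    then show ?thesis using a by (auto intro!: negligible_hyperplane)
  qed
  have scale: "((\<lambda>c. c *s x) \<longlongrightarrow> x) (nhds 1)"
    by (rule vec_tendstoI) (auto intro!: tendsto_eq_intros filterlim_ident)
  have "\<forall>\<^sub>F c in nhds 1. c *s x \<in> interior D \<and> c \<noteq> 0"
    by (intro eventually_conj topological_tendstoD[OF scale open_interior x(1)] t1_space_nhds) simp
  then obtain U where U: "open U" "1 \<in> U" "\<And>c. c \<in> U \<Longrightarrow> c *s x \<in> interior D \<and> c \<noteq> 0"
    unfolding eventually_nhds by blast
  obtain c where c: "c \<in> U" "c \<notin> \<Union>\<A>"
    using open_avoids_negligible[OF U(1) _ \<open>finite \<A>\<close>] \<open>\<And>A. A \<in> \<A> \<Longrightarrow> negligible A\<close> U(2) by blast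
  define z where "z = c *s x"
  have z: "z \<in> interior D" "c \<noteq> 0" using U(3)[OF c(1)] by (auto simp: z_def)
  have pz: "eval_mpoly p z = 0"
    unfolding z_def by (rule complex_zero_on_line[OF ev x(1) px])
  have lin: "l (k *s v) = k * l v" if "l \<in> signed_coordinates" for l k and v :: "complex ^ 'n"
    using that by (auto simp: signed_coordinates_def)
  have generic: "l z = m z"
    if lm: "l \<in> signed_coordinates" "m \<in> signed_coordinates" and tie: "Re (l z) = Re (m z) \<or> Im (l z) = Im (m z)"
    for l m
  proof (rule ccontr)
    assume "l z \<noteq> m z"
    then have "l x - m x \<in> \<Delta>" using lm by (auto simp: \<Delta>_def z_def lin)
    then show False
      using c(2) tie lm by (auto simp: \<A>_def z_def lin right_diff_distrib)
  qed
  let ?Y = "{rescale z g | g. range g \<subseteq> sphere 0 1}"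
  have "keeps_ties {Re, Im, cmod} z y" if yY: "y \<in> ?Y" for y
  proof -
    obtain g where y: "y = rescale z g" "range g \<subseteq> sphere 0 1" using yY by blast
    have eq: "l y = m y" if "l \<in> signed_coordinates" "m \<in> signed_coordinates" "l z = m z" for l m
      using rescale_in_allowable_hull[of z g] that y(1) by (simp add: allowable_hull_iff)
    have "cmod (g v) = 1" for v using y(2) by (auto simp: image_subset_iff)
    then have mod: "cmod (l y) = cmod (l z)" if "l \<in> signed_coordinates" for l
      using that by (auto simp: signed_coordinates_def y(1) rescale_def norm_mult)
    have "\<phi> (l y) = \<phi> (m y)"
      if lm: "l \<in> signed_coordinates" "m \<in> signed_coordinates"
        and \<phi>: "\<phi> \<in> {Re, Im, cmod}" and tie: "\<phi> (l z) = \<phi> (m z)" for l m \<phi>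
    proof (cases "\<phi> = cmod")
      case True
      then show ?thesis using mod lm tie by metis
    next
      case False
      then have "l z = m z" using generic[OF lm] \<phi> tie by blast
      then show ?thesis using eq[OF lm] by simp
    qed
    then show ?thesis unfolding keeps_ties_def using eq by blast
  qed
  then have "\<forall>\<^sub>F y in at z within ?Y. keeps_ties {Re, Im, cmod} z y"
    unfolding eventually_at_filter by (intro always_eventually) blast
  then have "\<forall>\<^sub>F y in at z within ?Y. eval_mpoly p y = 0"
    using key_Re key_Im key_cmod ev z(1) pz unfolding complex_comparisons_eq
    by (intro zero_along_ties[where x=z and D=D and \<Phi>="{Re, Im, cmod}"]) (auto intro: tendsto_ident_at)
  moreover have "(1::complex) islimpt sphere 0 1"
  proof (rule connected_imp_perfect)
    show "connected (sphere (0::complex) 1)" by (rule connected_sphere) simp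
    show "sphere (0::complex) 1 \<noteq> {a}" for a
    proof
      assume "sphere (0::complex) 1 = {a}"
      moreover have "1 \<in> sphere (0::complex) 1" "- 1 \<in> sphere (0::complex) 1" by auto
      ultimately show False by (metis one_neq_neg_one singletonD)
    qed
  qed simp
  ultimately have "allowable_hull z \<subseteq> variety p"
    using pz by (intro allowable_hull_in_variety)
  moreover have "x \<in> allowable_hull z"
    unfolding allowable_hull_iff using z(2) by (auto simp: z_def lin)
  ultimately show False using not_general_position x(2) by blast
qed

theorem theorem3p10:
  shows "(\<forall>(D :: (real ^ 'n::finite) set) (p :: ('n, real) mpoly).
            D = closure (interior D) \<longrightarrow> interior D \<inter> general_position p \<noteq> {} \<longrightarrow>
            \<not> accurately_evaluable real_comparisons p D) \<and>
         (\<forall>(D :: (complex ^ 'n) set) (p :: ('n, complex) mpoly).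
            D = closure (interior D) \<longrightarrow> interior D \<inter> general_position p \<noteq> {} \<longrightarrow>
            \<not> accurately_evaluable complex_comparisons p D)"
  using real_not_accurately_evaluable complex_not_accurately_evaluable by blast

end
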